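(* Let $L\ge 4$ be an even integer, $u>0$, $\tau>0$, and consider the Hubbard Hamiltonian $H=H_I+H_h^p+H_h^g$ on the periodic $L\times L$ square lattice, with hopping part $H_h=H_h^p+H_h^g$ split into its pink and gold plaquette parts. Let $$W_{SO2}=\frac{1}{12}\big\|[[H_I,H_h],H_h]\big\|+\frac1{24}\big\|[[H_I,H_h],H_I]\big\| .$$ Then there is a constant $W_{PLAQ}\ge0$ with $$W_{PLAQ}\le W_{SO2}+\frac{3}{24}\big\|[[H_h^p,H_h^g],H_h^g]\big\|$$ such that for all $t\ge0$ $$\left\|e^{itH}-e^{i(t/2)H_I}e^{i(t/2)H_h^p}e^{itH_h^g}e^{i(t/2)H_h^p}e^{i(t/2)H_I}\right\|\le W_{PLAQ}\,t^3 .$$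
   Context: The lattice sites are the elements of $(\mathbb{Z}/L\mathbb{Z})^2$; two sites are nearest neighbours if they differ by $(\pm1,0)$ or $(0,\pm1)$ modulo $L$, and an edge is an unordered pair of nearest neighbours. For each site $i$ and spin $\sigma\in\{\uparrow,\downarrow\}$ there is a fermionic mode with annihilation operator $a_{i,\sigma}$, satisfying the canonical anticommutation relations on the Fock space of these $2L^2$ modes. Put $\hat n_{i,\sigma}=a_{i,\sigma}^\dagger a_{i,\sigma}$ and $\hat z_{i,\sigma}=2\hat n_{i,\sigma}-\mathbb{1}$. The interaction Hamiltonian is $H_I=\frac{u}{4}\sum_i \hat z_{i,\uparrow}\hat z_{i,\downarrow}$; the hopping Hamiltonian is $H_h=\tau\sum_\sigma\sum_{\{i,j\}\text{ edge}}(a_{i,\sigma}^\dagger a_{j,\sigma}+a_{j,\sigma}^\dagger a_{i,\sigma})$. The plaquette (unit square) with lower-left corner $(x,y)$ has vertices $(x,y),(x+1,y),(x+1,y+1),(x,y+1)$ (mod $L$) and the four edges around it. The pink plaquettes are those with $x,y$ both even, and the gold plaquettes are those with $x,y$ both odd; for even $L$ every edge belongs to exactly one pink or gold plaquette. $H_h^p$ (resp. $H_h^g$) is the part of $H_h$ given by the sum over edges of pink (resp. gold) plaquettes, so $H_h=H_h^p+H_h^g$. $\|\cdot\|$ is the operator norm. *)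

theory Defs
  imports "HOL-Analysis.Analysis" "Berlekamp_Zassenhaus.Finite_Field"
begin

section \<open>Complex matrices as operators\<close>

text \<open>
  \<^typ>\<open>complex ^ 'n\<close> carries the Euclidean norm. The instance \<open>*\<close> on matrices is
  entrywise, so that the library constants \<open>^\<close> and \<open>exp\<close> are not the matrix power and the matrix
  exponential. The product of operators is \<open>**\<close> and the exponential is introduced below.
\<close>

definition cscale :: "complex \<Rightarrow> complex ^ 'n ^ 'm \<Rightarrow> complex ^ 'n ^ 'm"  (infixr \<open>*\<^sub>C\<close> 75)
  where "c *\<^sub>C A = (\<chi> i j. c * A $ i $ j)"

definition dagger :: "complex ^ 'n ^ 'm \<Rightarrow> complex ^ 'm ^ 'n"
  where "dagger A = (\<chi> i j. cnj (A $ j $ i))"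

definition comm :: "complex ^ 'n ^ 'n \<Rightarrow> complex ^ 'n ^ 'n \<Rightarrow> complex ^ 'n ^ 'n"
  where "comm A B = A ** B - B ** A"

definition opnorm :: "complex ^ 'n ^ 'm \<Rightarrow> real"
  where "opnorm A = onorm (\<lambda>v. A *v v)"

definition mexp :: "complex ^ 'n ^ 'n \<Rightarrow> complex ^ 'n ^ 'n"
  where "mexp A = (\<Sum>k. (1 / fact k) *\<^sub>R (((**) A ^^ k) (mat 1)))"


section \<open>Fock space of finitely many fermionic modes\<close>

text \<open>
  The Fock space over a finite type \<open>'m\<close> of modes has the orthonormal basis of occupation-number
  states, which are labelled by the sets \<open>S\<close> of occupied modes. The Jordan--Wigner sign depends on
  an enumeration of the modes; another enumeration gives a unitarily equivalent system.
\<close>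

type_synonym 'm fock_op = "complex ^ ('m set) ^ ('m set)"

definition jw_sign :: "'m::finite \<Rightarrow> 'm set \<Rightarrow> complex"
  where "jw_sign m S = (-1) ^ card {k \<in> S. to_nat k < to_nat m}"

definition annih :: "'m::finite \<Rightarrow> 'm fock_op"
  where "annih m = (\<chi> T S. if m \<in> S \<and> T = S - {m} then jw_sign m S else 0)"

abbreviation creat :: "'m::finite \<Rightarrow> 'm fock_op"
  where "creat m \<equiv> dagger (annih m)"

definition number_op :: "'m::finite \<Rightarrow> 'm fock_op"
  where "number_op m = creat m ** annih m"

definition z_op :: "'m::finite \<Rightarrow> 'm fock_op"
  where "z_op m = 2 *\<^sub>C number_op m - mat 1"

lemma jw_sign_remove:
  assumes "n \<in> S"
  shows "jw_sign m (S - {n}) = (if to_nat n < to_nat m then - jw_sign m S else jw_sign m S)"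
proof (cases "to_nat n < to_nat m")
  case True
  have "{k \<in> S. to_nat k < to_nat m} = insert n {k \<in> S - {n}. to_nat k < to_nat m}"
    using assms True by auto
  then have "card {k \<in> S. to_nat k < to_nat m} = Suc (card {k \<in> S - {n}. to_nat k < to_nat m})"
    by (simp add: card_insert_if)
  then show ?thesis using True by (simp add: jw_sign_def)
next
  case False
  then have "{k \<in> S - {n}. to_nat k < to_nat m} = {k \<in> S. to_nat k < to_nat m}" by auto
  then show ?thesis using False by (simp add: jw_sign_def)
qed

lemma jw_sign_cnj [simp]: "cnj (jw_sign m S) = jw_sign m S"
  by (simp add: jw_sign_def)

lemma jw_sign_square [simp]: "jw_sign m S * jw_sign m S = 1"
  by (simp add: jw_sign_def flip: power_mult_distrib)

lemma sum_UNIV_single: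
  fixes f :: "'a::finite \<Rightarrow> complex"
  assumes "\<And>x. x \<noteq> a \<Longrightarrow> f x = 0"
  shows "(\<Sum>x\<in>UNIV. f x) = f a"
proof -
  have "(\<Sum>x\<in>{a}. f x) = (\<Sum>x\<in>UNIV. f x)"
    by (rule sum.mono_neutral_left) (auto simp: assms)
  then show ?thesis by simp
qed

lemma annih_annih_entry:
  "(annih m ** annih n) $ T $ S =
    (if n \<in> S \<and> m \<in> S - {n} \<and> T = S - {n} - {m} then jw_sign m (S - {n}) * jw_sign n S else 0)"
proof -
  have "(annih m ** annih n) $ T $ S = (\<Sum>R\<in>UNIV. annih m $ T $ R * annih n $ R $ S)"
    by (simp add: matrix_matrix_mult_def)
  also have "\<dots> = annih m $ T $ (S - {n}) * annih n $ (S - {n}) $ S"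
    by (rule sum_UNIV_single) (simp add: annih_def)
  finally show ?thesis by (simp add: annih_def)
qed

lemma annih_creat_entry:
  "(annih m ** creat n) $ T $ S =
    (if n \<notin> S \<and> m \<in> insert n S \<and> T = insert n S - {m}
     then jw_sign m (insert n S) * jw_sign n (insert n S) else 0)"
proof -
  have "(annih m ** creat n) $ T $ S = (\<Sum>R\<in>UNIV. annih m $ T $ R * creat n $ R $ S)"
    by (simp add: matrix_matrix_mult_def)
  also have "\<dots> = annih m $ T $ insert n S * creat n $ insert n S $ S"
    by (rule sum_UNIV_single) (auto simp: annih_def dagger_def)
  finally show ?thesis by (auto simp: annih_def dagger_def)
qed

lemma creat_annih_entry:
  "(creat n ** annih m) $ T $ S =
    (if m \<in> S \<and> n \<notin> S - {m} \<and> T = insert n (S - {m})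
     then jw_sign n T * jw_sign m S else 0)"
proof -
  have "(creat n ** annih m) $ T $ S = (\<Sum>R\<in>UNIV. creat n $ T $ R * annih m $ R $ S)"
    by (simp add: matrix_matrix_mult_def)
  also have "\<dots> = creat n $ T $ (S - {m}) * annih m $ (S - {m}) $ S"
    by (rule sum_UNIV_single) (simp add: annih_def)
  moreover have "n \<in> T \<and> S - {m} = T - {n} \<longleftrightarrow> n \<notin> S - {m} \<and> T = insert n (S - {m})" by auto
  ultimately show ?thesis by (simp add: annih_def dagger_def)
qed

text \<open>The canonical anticommutation relations.\<close>

lemma CAR_annih: "annih m ** annih n + annih n ** annih m = 0"
proof (cases "m = n")
  case True
  then show ?thesis by (simp add: vec_eq_iff annih_annih_entry)
next
  case False
  then have "to_nat m \<noteq> to_nat n" by simp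
  then show ?thesis using False
    by (auto simp: vec_eq_iff annih_annih_entry jw_sign_remove Diff_insert2[symmetric] insert_commute)
qed

lemma CAR_annih_creat: "annih m ** creat n + creat n ** annih m = (if m = n then mat 1 else 0)"
proof (cases "m = n")
  case True
  then show ?thesis
    by (auto simp: vec_eq_iff annih_creat_entry creat_annih_entry mat_def insert_absorb)
next
  case False
  then have ne: "to_nat m \<noteq> to_nat n" by simp
  have "(annih m ** creat n + creat n ** annih m) $ T $ S = 0" for T S
  proof (cases "m \<in> S \<and> n \<notin> S \<and> T = insert n S - {m}")
    case True
    have "jw_sign m S = (if to_nat n < to_nat m then - jw_sign m (insert n S) else jw_sign m (insert n S))"
      using jw_sign_remove[of n "insert n S" m] True by simp
    moreover have "jw_sign n T = (if to_nat m < to_nat n then - jw_sign n (insert n S) else jw_sign n (insert n S))"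
      using jw_sign_remove[of m "insert n S" n] True by simp
    moreover have "insert n S - {m} = insert n (S - {m})" using False by auto
    ultimately show ?thesis using True False ne
      by (auto simp: annih_creat_entry creat_annih_entry)
  next
    case nt: False
    then show ?thesis using False
      by (auto simp: annih_creat_entry creat_annih_entry)
  qed
  then show ?thesis using False by (simp add: vec_eq_iff)
qed


section \<open>The Hubbard model on the periodic square lattice\<close>

datatype spin = Up | Down

instance spin :: finite
proof
  have "(UNIV :: spin set) = {Up, Down}" using spin.exhaust by auto
  then show "finite (UNIV :: spin set)" by (metis finite.emptyI finite.insertI)
qed

text \<open>
  The type \<^typ>\<open>'l mod_ring\<close> is the ring of integers modulo \<open>L = CARD('l)\<close>, and
  \<^term>\<open>to_int_mod_ring x\<close> is the representative of \<open>x\<close> in \<open>{0..<L}\<close>.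
\<close>

type_synonym 'l site = "'l mod_ring \<times> 'l mod_ring"
type_synonym 'l hubbard_op = "('l site \<times> spin) fock_op"

definition nearest :: "'l::nontriv site \<Rightarrow> 'l site \<Rightarrow> bool"
  where "nearest i j \<longleftrightarrow> j - i \<in> {(1, 0), (-1, 0), (0, 1), (0, -1)}"

definition edges :: "'l::nontriv site set set"
  where "edges = {{i, j} | i j. nearest i j}"

definition plaquette_edges :: "'l::nontriv site \<Rightarrow> 'l site set set"
  where "plaquette_edges = (\<lambda>(x, y).
    {{(x, y), (x + 1, y)}, {(x + 1, y), (x + 1, y + 1)},
     {(x + 1, y + 1), (x, y + 1)}, {(x, y + 1), (x, y)}})"

definition pink_edges :: "'l::nontriv site set set"
  where "pink_edges =
    \<Union> {plaquette_edges (x, y) | x y. even (to_int_mod_ring x) \<and> even (to_int_mod_ring y)}"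

definition gold_edges :: "'l::nontriv site set set"
  where "gold_edges =
    \<Union> {plaquette_edges (x, y) | x y. odd (to_int_mod_ring x) \<and> odd (to_int_mod_ring y)}"

text \<open>
  The sum over the two orderings \<open>(i, j)\<close>, \<open>(j, i)\<close> of an unordered pair makes the hopping term
  of an edge well-defined.
\<close>

definition hop_term :: "spin \<Rightarrow> 'l::nontriv site set \<Rightarrow> 'l hubbard_op"
  where "hop_term \<sigma> e = (\<Sum>(i, j) \<in> {(i, j). {i, j} = e}. creat (i, \<sigma>) ** annih (j, \<sigma>))"

lemma hop_term_pair:
  assumes "i \<noteq> j"
  shows "hop_term \<sigma> {i, j} =
    creat (i, \<sigma>) ** annih (j, \<sigma>) + creat (j, \<sigma>) ** annih (i, \<sigma>)"
proof -
  have "{(i', j'). {i', j'} = {i, j}} = {(i, j), (j, i)}"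
    by (auto simp: doubleton_eq_iff)
  then show ?thesis using assms by (simp add: hop_term_def)
qed

definition hopping_on :: "'l::nontriv site set set \<Rightarrow> real \<Rightarrow> 'l hubbard_op"
  where "hopping_on E \<tau> = \<tau> *\<^sub>R (\<Sum>\<sigma>\<in>UNIV. \<Sum>e\<in>E. hop_term \<sigma> e)"

definition H_int :: "real \<Rightarrow> 'l::nontriv hubbard_op"
  where "H_int u = (u / 4) *\<^sub>R (\<Sum>i\<in>UNIV. z_op (i, Up) ** z_op (i, Down))"

definition H_hop :: "real \<Rightarrow> 'l::nontriv hubbard_op"
  where "H_hop \<tau> = hopping_on edges \<tau>"

definition H_pink :: "real \<Rightarrow> 'l::nontriv hubbard_op"
  where "H_pink \<tau> = hopping_on pink_edges \<tau>"

definition H_gold :: "real \<Rightarrow> 'l::nontriv hubbard_op"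
  where "H_gold \<tau> = hopping_on gold_edges \<tau>"

definition W_SO2 :: "'l::nontriv hubbard_op \<Rightarrow> 'l hubbard_op \<Rightarrow> real"
  where "W_SO2 H\<^sub>I H\<^sub>h =
    1/12 * opnorm (comm (comm H\<^sub>I H\<^sub>h) H\<^sub>h) + 1/24 * opnorm (comm (comm H\<^sub>I H\<^sub>h) H\<^sub>I)"

end

(*
  Differentiating S(t) = e^{tX/2} e^{tY} e^{tX/2} gives S' = (X + Y) S + e^{tX/2} T e^{tY} e^{tX/2},
  where T is the difference of the second-order Taylor remainders of e^{tY} (X/2) e^{-tY} and of
  e^{-tX/2} Y e^{tX/2}. For skew-Hermitian X, Y all exponentials are isometries, so
  |T| <= t^2/4 |[Y,[Y,X]]| + t^2/8 |[X,[X,Y]]|, and integration gives the factors 1/12 and 1/24.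
  Splitting first H = H_I + H_h and then H_h = Hp + Hg costs W_SO2 plus
  1/12 |[[Hp,Hg],Hg]| + 1/24 |[[Hp,Hg],Hp]|. Translation by (1,1) is implemented by a unitary that
  exchanges Hp and Hg, so the two double commutators have the same norm: 1/12 + 1/24 = 3/24.
*)

theory Submission
  imports Defs
begin

section \<open>The Trotter error in a Banach algebra\<close>

text \<open>The estimate needs an algebra whose product is composition and whose norm is the
  operator norm. The instances on the matrix type are the entrywise product and the Euclidean norm,
  so the calculus is done in an abstract Banach algebra, applied to bounded endomorphisms, and
  carried back to \<open>opnorm\<close> and \<open>mexp\<close> by a homomorphism. The error is
  cubic because the splitting is symmetric: both conjugations have the same linear Taylor term
  t[Y, X/2], which cancels in their difference. Translation is not implemented by a bare permutation
  of the occupation states. It does not respect the enumeration of the modes, so the Jordan-Wigner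
  signs change and the permutation has to carry a compensating sign. Even L makes parity alternate
  all the way around the torus, so that the shift exchanges the colours. For L = 2 the pink and the
  gold plaquette have the same four edges and Hp + Hg would count each edge twice; L >= 4 excludes
  this.\<close>

lemma norm_le_of_vector_derivative_le_power:
  fixes f :: "real \<Rightarrow> 'a::real_normed_vector"
  assumes "f 0 = 0"
    and d: "\<And>s. (f has_vector_derivative f' s) (at s)"
    and b: "\<And>s. 0 \<le> s \<Longrightarrow> norm (f' s) \<le> c * s ^ k"
    and "0 \<le> t"
  shows "norm (f t) \<le> c * t ^ Suc k / Suc k"
\<comment> \<open>The mean value inequality used below requires a nondegenerate interval.\<close>
proof (cases "t = 0")
  case True
  then show ?thesis using assms by simp
next
  case False
  then have "0 < t" using \<open>0 \<le> t\<close> by simp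
  then have "norm (f t - f 0) \<le> c * t ^ Suc k / Suc k - c * 0 ^ Suc k / Suc k"
  proof (rule differentiable_bound_general[where f' = f' and \<phi>' = "\<lambda>s. c * s ^ k"
        and \<phi> = "\<lambda>s. c * s ^ Suc k / Suc k"])
    show "continuous_on {0..t} f"
      using d by (meson continuous_at_imp_continuous_on has_vector_derivative_continuous)
    show "continuous_on {0..t} (\<lambda>s. c * s ^ Suc k / Suc k)"
      by (intro continuous_intros) auto
    show "((\<lambda>s. c * s ^ Suc k / Suc k) has_vector_derivative c * x ^ k) (at x)" for x
      unfolding has_real_derivative_iff_has_vector_derivative[symmetric]
      by (auto intro!: derivative_eq_intros simp del: of_nat_Suc power_Suc)
  qed (use d b in auto)
  then show ?thesis using \<open>f 0 = 0\<close> by simp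
qed

section \<open>Conjugation by a one-parameter group of contractions\<close>

context
  fixes Y :: "'a::{real_normed_algebra_1, banach}"
  assumes contr: "\<And>t. norm (exp (t *\<^sub>R Y)) \<le> 1"
begin

lemma norm_exp_conj_le: "norm (exp (t *\<^sub>R Y) * Z * exp (t *\<^sub>R (- Y))) \<le> norm Z"
proof -
  \<comment> \<open>\<open>contr\<close> covers negative times, so the inverse factor is a
    contraction as well.\<close>
  have "norm (exp (t *\<^sub>R (- Y))) \<le> 1" using contr[of "- t"] by simp
  have "norm (exp (t *\<^sub>R Y) * Z * exp (t *\<^sub>R (- Y)))
    \<le> norm (exp (t *\<^sub>R Y)) * norm Z * norm (exp (t *\<^sub>R (- Y)))"
    by (meson norm_mult_ineq mult_right_mono norm_ge_zero order_trans)
  also have "\<dots> \<le> 1 * norm Z * 1"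
    using contr[of t] \<open>norm (exp (t *\<^sub>R (- Y))) \<le> 1\<close> by (intro mult_mono) auto
  finally show ?thesis by simp
qed

lemma exp_conj_has_vector_derivative:
  "((\<lambda>t. exp (t *\<^sub>R Y) * Z * exp (t *\<^sub>R (- Y))) has_vector_derivative
     exp (t *\<^sub>R Y) * (Y * Z - Z * Y) * exp (t *\<^sub>R (- Y))) (at t)"
proof -
  have "((\<lambda>t. exp (t *\<^sub>R Y) * Z * exp (t *\<^sub>R (- Y))) has_vector_derivative
     (exp (t *\<^sub>R Y) * Z) * (- Y * exp (t *\<^sub>R (- Y))) +
     (exp (t *\<^sub>R Y) * 0 + exp (t *\<^sub>R Y) * Y * Z) * exp (t *\<^sub>R (- Y))) (at t)"
    by (intro has_vector_derivative_mult exp_scaleR_has_vector_derivative_left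
        exp_scaleR_has_vector_derivative_right has_vector_derivative_const)
  moreover have "(exp (t *\<^sub>R Y) * Z) * (- Y * exp (t *\<^sub>R (- Y))) +
     (exp (t *\<^sub>R Y) * 0 + exp (t *\<^sub>R Y) * Y * Z) * exp (t *\<^sub>R (- Y))
    = exp (t *\<^sub>R Y) * (Y * Z - Z * Y) * exp (t *\<^sub>R (- Y))"
    by (simp add: algebra_simps)
  ultimately show ?thesis by simp
qed

text \<open>The derivative of the conjugated \<open>Z\<close> is the conjugated commutator, which is
  no larger than the commutator itself; one integration gives the factor \<open>t\<close>.\<close>

lemma norm_exp_conj_remainder_1:
  assumes "0 \<le> t"
  shows "norm (exp (t *\<^sub>R Y) * Z * exp (t *\<^sub>R (- Y)) - Z) \<le> t * norm (Y * Z - Z * Y)"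
proof -
  have "norm (exp (t *\<^sub>R Y) * Z * exp (t *\<^sub>R (- Y)) - Z)
    \<le> norm (Y * Z - Z * Y) * t ^ Suc 0 / Suc 0"
  proof (rule norm_le_of_vector_derivative_le_power[where f = "\<lambda>t. exp (t *\<^sub>R Y) * Z * exp (t *\<^sub>R (- Y)) - Z"])
    show "((\<lambda>t. exp (t *\<^sub>R Y) * Z * exp (t *\<^sub>R (- Y)) - Z) has_vector_derivative
      exp (s *\<^sub>R Y) * (Y * Z - Z * Y) * exp (s *\<^sub>R (- Y))) (at s)" for s
      using has_vector_derivative_diff[OF exp_conj_has_vector_derivative has_vector_derivative_const]
      by simp
    show "norm (exp (s *\<^sub>R Y) * (Y * Z - Z * Y) * exp (s *\<^sub>R (- Y)))
      \<le> norm (Y * Z - Z * Y) * s ^ 0" for s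
      using norm_exp_conj_le by simp
  qed (use assms in auto)
  then show ?thesis by (simp add: mult.commute)
qed

lemma norm_exp_conj_remainder_2:
  assumes "0 \<le> t"
  shows "norm (exp (t *\<^sub>R Y) * Z * exp (t *\<^sub>R (- Y)) - Z - t *\<^sub>R (Y * Z - Z * Y))
    \<le> t\<^sup>2 / 2 * norm (Y * (Y * Z - Z * Y) - (Y * Z - Z * Y) * Y)"
proof -
  let ?C = "Y * Z - Z * Y"
  have "norm (exp (t *\<^sub>R Y) * Z * exp (t *\<^sub>R (- Y)) - Z - t *\<^sub>R ?C)
    \<le> norm (Y * ?C - ?C * Y) * t ^ Suc 1 / Suc 1"
  proof (rule norm_le_of_vector_derivative_le_power[where
        f = "\<lambda>t. exp (t *\<^sub>R Y) * Z * exp (t *\<^sub>R (- Y)) - Z - t *\<^sub>R ?C"])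
    have "((\<lambda>t. t *\<^sub>R ?C) has_vector_derivative ?C) (at s)" for s
      by (auto intro!: derivative_eq_intros)
    then show "((\<lambda>t. exp (t *\<^sub>R Y) * Z * exp (t *\<^sub>R (- Y)) - Z - t *\<^sub>R ?C) has_vector_derivative
      exp (s *\<^sub>R Y) * ?C * exp (s *\<^sub>R (- Y)) - ?C) (at s)" for s
      using has_vector_derivative_diff[OF has_vector_derivative_diff[OF
          exp_conj_has_vector_derivative has_vector_derivative_const]] by simp
    \<comment> \<open>The derivative of the second remainder of \<open>Z\<close> is the first
      remainder of the commutator \<open>?C\<close>, so the previous bound is integrated once
      more.\<close>
    show "norm (exp (s *\<^sub>R Y) * ?C * exp (s *\<^sub>R (- Y)) - ?C) \<le> norm (Y * ?C - ?C * Y) * s ^ 1"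
      if "0 \<le> s" for s
      using norm_exp_conj_remainder_1[OF that, of ?C] by (simp add: mult.commute)
  qed (use assms in auto)
  then show ?thesis by (simp add: mult.commute power2_eq_square)
qed

end

section \<open>Error of the symmetric splitting of two generators\<close>

lemma strang_splitting_error:
  fixes X Y :: "'a::{real_normed_algebra_1, banach}"
  assumes contrX: "\<And>t. norm (exp (t *\<^sub>R X)) \<le> 1"
    and contrY: "\<And>t. norm (exp (t *\<^sub>R Y)) \<le> 1"
    and contrXY: "\<And>t. norm (exp (t *\<^sub>R (X + Y))) \<le> 1"
    and "0 \<le> t"
  shows "norm (exp (t *\<^sub>R (X + Y)) - exp ((t/2) *\<^sub>R X) * exp (t *\<^sub>R Y) * exp ((t/2) *\<^sub>R X))
    \<le> (1/12 * norm (Y * (Y * X - X * Y) - (Y * X - X * Y) * Y)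
       + 1/24 * norm (X * (X * Y - Y * X) - (X * Y - Y * X) * X)) * t ^ 3"
proof -
  define P where "P = (1/2) *\<^sub>R X"
  let ?D1 = "Y * (Y * P - P * Y) - (Y * P - P * Y) * Y"
  let ?D2 = "P * (P * Y - Y * P) - (P * Y - Y * P) * P"
  define U V where "U s = exp (s *\<^sub>R P)" and "V s = exp (s *\<^sub>R Y)" for s
  define U' V' where "U' s = exp (s *\<^sub>R (- P))" and "V' s = exp (s *\<^sub>R (- Y))" for s
  define E where "E s = exp (s *\<^sub>R (- (X + Y)))" for s
  \<comment> \<open>Chosen so that \<open>U s * T s * V s * U s\<close> is what remains of the
    derivative of \<open>U s * V s * U s\<close> after subtracting
    \<open>(X + Y) * U s * V s * U s\<close>.\<close>
  define T where "T s = V s * P * V' s + P + Y - U' s * (2 *\<^sub>R P + Y) * U s" for s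
  have X: "X = 2 *\<^sub>R P" by (simp add: P_def)
  have UU': "U s * U' s = 1" and U'U: "U' s * U s = 1" and V'V: "V' s * V s = 1" for s
    using exp_minus_inverse[of "s *\<^sub>R P"] exp_minus_inverse[of "- (s *\<^sub>R P)"]
      exp_minus_inverse[of "- (s *\<^sub>R Y)"]
    by (simp_all add: U_def U'_def V_def V'_def)
  have UP: "U s * P = P * U s" for s
    unfolding U_def by (rule exp_times_scaleR_commute)
  have nU: "norm (U s) \<le> 1" for s using contrX[of "s / 2"] by (simp add: U_def P_def)
  have nV: "norm (V s) \<le> 1" for s using contrY by (simp add: V_def)
  have nE: "norm (E s) \<le> 1" for s
    using contrXY[of "- s"] by (simp only: E_def scaleR_minus_left scaleR_minus_right)
  have contrP: "norm (exp (s *\<^sub>R - P)) \<le> 1" for s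
    using nU[of "- s"] by (simp add: U_def)
  have dG: "((\<lambda>s. E s * (U s * (V s * U s)) - 1) has_vector_derivative
      E s * (U s * T s * V s * U s)) (at s)" for s
  proof -
    \<comment> \<open>\<open>E s\<close> is differentiated with its generator on the right, where
      -(X + Y) meets the product \<open>U s * V s * U s\<close> and cancels the leading part of its
      derivative.\<close>
    have "((\<lambda>s. E s * (U s * (V s * U s))) has_vector_derivative
        E s * (U s * (V s * (P * U s) + (Y * V s) * U s) + (P * U s) * (V s * U s))
        + (E s * - (X + Y)) * (U s * (V s * U s))) (at s)"
      unfolding E_def U_def V_def
      by (intro has_vector_derivative_mult exp_scaleR_has_vector_derivative_left
        exp_scaleR_has_vector_derivative_right)
    moreover have "U s * T s * V s * U s = U s * V s * P * (V' s * V s) * U s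
        + (U s * P) * V s * U s + U s * Y * V s * U s
        - (U s * U' s) * (2 *\<^sub>R P + Y) * U s * V s * U s"
      unfolding T_def by (simp add: algebra_simps)
    then have T: "U s * T s * V s * U s = U s * V s * P * U s + P * U s * V s * U s
        + U s * Y * V s * U s - (2 *\<^sub>R P + Y) * U s * V s * U s"
      unfolding V'V UU' UP by simp
    have "E s * (U s * (V s * (P * U s) + (Y * V s) * U s) + (P * U s) * (V s * U s))
        + (E s * - (X + Y)) * (U s * (V s * U s)) = E s * (U s * T s * V s * U s)"
      unfolding X T
      by (simp add: distrib_left distrib_right left_diff_distrib right_diff_distrib mult.assoc scaleR_2)
    ultimately have "((\<lambda>s. E s * (U s * (V s * U s))) has_vector_derivative
        E s * (U s * T s * V s * U s)) (at s)" by metis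
    then show ?thesis
      unfolding has_vector_derivative_diff_const .
  qed
  have nT: "norm (T s) \<le> s\<^sup>2 / 2 * norm ?D1 + s\<^sup>2 / 2 * norm ?D2" if "0 \<le> s" for s
  proof -
    \<comment> \<open>The linear terms of \<open>?R1\<close> and \<open>?R2\<close> are equal, since
      (-P)Y - Y(-P) = YP - PY. Subtracting them therefore leaves \<open>T s\<close>
      unchanged.\<close>
    let ?R1 = "V s * P * V' s - P - s *\<^sub>R (Y * P - P * Y)"
    let ?R2 = "U' s * Y * U s - Y - s *\<^sub>R ((- P) * Y - Y * (- P))"
    \<comment> \<open>Half of X commutes with its own exponential, so only the conjugate of Y
      contributes a remainder.\<close>
    have UPU: "U' s * P * U s = P"
      by (simp only: mult.assoc UP[symmetric]) (simp only: mult.assoc[symmetric] U'U mult_1_left)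
    have "T s = V s * P * V' s + P + Y - (2 *\<^sub>R (U' s * P * U s) + U' s * Y * U s)"
      by (simp add: T_def distrib_left distrib_right)
    also have "\<dots> = ?R1 - ?R2"
      unfolding UPU by (simp add: scaleR_2 scaleR_diff_right)
    finally have T: "T s = ?R1 - ?R2" .
    have R1: "norm ?R1 \<le> s\<^sup>2 / 2 * norm ?D1"
      using norm_exp_conj_remainder_2[OF contrY that, of P] by (simp add: V_def V'_def)
    have R2: "norm ?R2 \<le> s\<^sup>2 / 2 * norm ?D2"
    proof -
      have "norm ?R2 \<le> s\<^sup>2 / 2 * norm (- P * (- P * Y - Y * - P) - (- P * Y - Y * - P) * - P)"
        using norm_exp_conj_remainder_2[OF contrP that, of Y] unfolding U_def U'_def minus_minus .
      also have "- P * (- P * Y - Y * - P) - (- P * Y - Y * - P) * - P = ?D2"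
        by (simp add: algebra_simps)
      finally show ?thesis .
    qed
    show ?thesis
      unfolding T by (rule norm_triangle_le_diff[OF add_mono[OF R1 R2]])
  qed
  \<comment> \<open>Integrating \<open>c * s ^ 2\<close> gives a factor 1/3. \<open>?D1\<close> is
    linear in P = X/2 and \<open>?D2\<close> quadratic, whence 1/2 * 1/2 * 1/3 = 1/12 and 1/2 * 1/4
    * 1/3 = 1/24.\<close>
  define c where "c = (norm ?D1 + norm ?D2) / 2"
  have le: "norm (E t * (U t * (V t * U t)) - 1) \<le> c * t ^ Suc 2 / Suc 2"
  proof (rule norm_le_of_vector_derivative_le_power[where
        f = "\<lambda>s. E s * (U s * (V s * U s)) - 1" and f' = "\<lambda>s. E s * (U s * T s * V s * U s)"])
    show "norm (E s * (U s * T s * V s * U s)) \<le> c * s ^ 2" if "0 \<le> s" for s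
    proof -
      have "norm (E s * (U s * T s * V s * U s))
        \<le> norm (E s) * (norm (U s) * norm (T s) * norm (V s) * norm (U s))"
        by (intro order_trans[OF norm_mult_ineq] mult_mono) auto
      also have "\<dots> \<le> 1 * (1 * norm (T s) * 1 * 1)"
        using nE nU nV by (intro mult_mono) auto
      finally show ?thesis
        using nT[OF that] by (simp add: c_def field_simps)
    qed
  qed (use dG \<open>0 \<le> t\<close> in \<open>auto simp: E_def U_def V_def\<close>)
  have nD: "norm ?D1 = norm (Y * (Y * X - X * Y) - (Y * X - X * Y) * Y) / 2"
    "norm ?D2 = norm (X * (X * Y - Y * X) - (X * Y - Y * X) * X) / 4"
  proof -
    have "?D1 = (1/2) *\<^sub>R (Y * (Y * X - X * Y) - (Y * X - X * Y) * Y)"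
      by (simp add: P_def left_diff_distrib right_diff_distrib scaleR_diff_right mult.assoc)
    then show "norm ?D1 = norm (Y * (Y * X - X * Y) - (Y * X - X * Y) * Y) / 2" by simp
    have "?D2 = (1/4) *\<^sub>R (X * (X * Y - Y * X) - (X * Y - Y * X) * X)"
      by (simp add: P_def left_diff_distrib right_diff_distrib scaleR_diff_right mult.assoc)
    then show "norm ?D2 = norm (X * (X * Y - Y * X) - (X * Y - Y * X) * X) / 4" by simp
  qed
  have "norm (exp (t *\<^sub>R (X + Y)) - U t * V t * U t) \<le> norm (E t * (U t * (V t * U t)) - 1)"
  proof -
    \<comment> \<open>Undoes the passage to the rotating frame: multiplying by the exact evolution,
      a contraction, turns the bound on \<open>E t * (U t * (V t * U t)) - 1\<close> into one on the
      splitting error.\<close>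
    have "exp (t *\<^sub>R (X + Y)) * E t = 1"
      using exp_minus_inverse[of "t *\<^sub>R (X + Y)"] by (simp only: E_def scaleR_minus_right)
    then have "exp (t *\<^sub>R (X + Y)) - U t * V t * U t
      = - (exp (t *\<^sub>R (X + Y)) * (E t * (U t * (V t * U t)) - 1))"
      unfolding right_diff_distrib mult.assoc[symmetric] by simp
    then have "norm (exp (t *\<^sub>R (X + Y)) - U t * V t * U t)
      \<le> norm (exp (t *\<^sub>R (X + Y))) * norm (E t * (U t * (V t * U t)) - 1)"
      by (metis norm_minus_cancel norm_mult_ineq)
    also have "\<dots> \<le> 1 * norm (E t * (U t * (V t * U t)) - 1)"
      using contrXY by (intro mult_right_mono) auto
    finally show ?thesis by simp
  qed
  from this le have "norm (exp (t *\<^sub>R (X + Y)) - U t * V t * U t) \<le> c * t ^ Suc 2 / Suc 2"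
    by (rule order_trans)
  also have "c * t ^ Suc 2 / Suc 2 = (1/12 * norm (Y * (Y * X - X * Y) - (Y * X - X * Y) * Y)
       + 1/24 * norm (X * (X * Y - Y * X) - (X * Y - Y * X) * X)) * t ^ 3"
    unfolding c_def nD by (simp add: field_simps)
  finally show ?thesis unfolding V_def U_def P_def by simp
qed


section \<open>Operators on a Banach space as a Banach algebra\<close>

text \<open>A type constructor with a single argument: a class instance takes distinct type
  variables, so it cannot single out the maps whose domain and codomain agree.\<close>

typedef (overloaded) 'a endo = "UNIV :: ('a::real_normed_vector \<Rightarrow>\<^sub>L 'a) set"
  by simp

setup_lifting type_definition_endo

text \<open>\<open>perfect_space\<close> excludes the zero space, on which the identity would have
  norm 0 instead of 1.\<close>

instantiation endo :: ("{banach, perfect_space}") real_normed_algebra_1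
begin

lift_definition zero_endo :: "'a endo" is 0 .
lift_definition one_endo :: "'a endo" is id_blinfun .
lift_definition plus_endo :: "'a endo \<Rightarrow> 'a endo \<Rightarrow> 'a endo" is "(+)" .
lift_definition minus_endo :: "'a endo \<Rightarrow> 'a endo \<Rightarrow> 'a endo" is "(-)" .
lift_definition uminus_endo :: "'a endo \<Rightarrow> 'a endo" is uminus .
lift_definition times_endo :: "'a endo \<Rightarrow> 'a endo \<Rightarrow> 'a endo" is "(o\<^sub>L)" .
lift_definition scaleR_endo :: "real \<Rightarrow> 'a endo \<Rightarrow> 'a endo" is scaleR .
lift_definition norm_endo :: "'a endo \<Rightarrow> real" is norm .

definition dist_endo :: "'a endo \<Rightarrow> 'a endo \<Rightarrow> real"
  where "dist_endo f g = norm (f - g)"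

definition sgn_endo :: "'a endo \<Rightarrow> 'a endo"
  where "sgn_endo f = inverse (norm f) *\<^sub>R f"

definition uniformity_endo :: "('a endo \<times> 'a endo) filter"
  where "uniformity_endo = (INF e\<in>{0<..}. principal {(f, g). dist f g < e})"

definition open_endo :: "'a endo set \<Rightarrow> bool"
  where "open_endo S = (\<forall>f\<in>S. \<forall>\<^sub>F (f', g) in uniformity. f' = f \<longrightarrow> g \<in> S)"

instance
proof
  fix f g h :: "'a endo" and r s :: real
  show "f + g + h = f + (g + h)" "f + g = g + f" "0 + f = f" "- f + f = 0" "f - g = f + - g"
    "r *\<^sub>R (f + g) = r *\<^sub>R f + r *\<^sub>R g" "(r + s) *\<^sub>R f = r *\<^sub>R f + s *\<^sub>R f"
    "r *\<^sub>R s *\<^sub>R f = (r * s) *\<^sub>R f" "1 *\<^sub>R f = f"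
    "(norm f = 0) = (f = 0)" "norm (f + g) \<le> norm f + norm g" "norm (r *\<^sub>R f) = \<bar>r\<bar> * norm f"
    by (transfer; simp add: algebra_simps norm_triangle_ineq)+
  show "f * g * h = f * (g * h)" "(f + g) * h = f * h + g * h" "f * (g + h) = f * g + f * h"
    "r *\<^sub>R f * g = r *\<^sub>R (f * g)" "f * r *\<^sub>R g = r *\<^sub>R (f * g)" "1 * f = f" "f * 1 = f"
    by (transfer; auto intro!: blinfun_eqI simp: blinfun.bilinear_simps)+
  show "norm (f * g) \<le> norm f * norm g"
    by transfer (rule norm_blinfun_compose)
  show norm_1: "norm (1 :: 'a endo) = 1"
    by transfer (rule norm_blinfun_id)
  show "(0 :: 'a endo) \<noteq> 1"
  proof
    assume "(0 :: 'a endo) = 1"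
    then have "norm (0 :: 'a endo) = 1" using norm_1 by simp
    then show False by transfer simp
  qed
  show "dist f g = norm (f - g)" "sgn f = inverse (norm f) *\<^sub>R f"
    by (simp_all add: dist_endo_def sgn_endo_def)
  show "(uniformity :: ('a endo \<times> 'a endo) filter) = (INF e\<in>{0<..}. principal {(f, g). dist f g < e})"
    by (rule uniformity_endo_def)
  show "open S = (\<forall>f\<in>S. \<forall>\<^sub>F (f', g) in uniformity. f' = f \<longrightarrow> g \<in> S)" for S :: "'a endo set"
    by (rule open_endo_def)
qed

end

instance endo :: ("{banach, perfect_space}") banach
proof
  fix F :: "nat \<Rightarrow> 'a endo"
  have dist_Rep: "dist f g = dist (Rep_endo f) (Rep_endo g)" for f g :: "'a endo"
    by (simp add: dist_endo_def dist_norm norm_endo.rep_eq minus_endo.rep_eq)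
  assume "Cauchy F"
  then have "Cauchy (\<lambda>n. Rep_endo (F n))"
    by (simp add: Cauchy_def dist_Rep)
  then obtain l where "(\<lambda>n. Rep_endo (F n)) \<longlonglongrightarrow> l"
    by (meson Cauchy_convergent convergent_def)
  then have "F \<longlonglongrightarrow> Abs_endo l"
    by (simp add: tendsto_iff dist_Rep Abs_endo_inverse)
  then show "convergent F" by (auto simp: convergent_def)
qed

definition endo_apply :: "'a::real_normed_vector endo \<Rightarrow> 'a \<Rightarrow> 'a"
  where "endo_apply f = blinfun_apply (Rep_endo f)"

lemma endo_eqI: "(\<And>v. endo_apply f v = endo_apply g v) \<Longrightarrow> f = g"
  unfolding endo_apply_def by (meson Rep_endo_inject blinfun_eqI)

lemma endo_apply_mult: "endo_apply (f * g) v = endo_apply f (endo_apply g v)"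
  by (simp add: endo_apply_def times_endo.rep_eq)

lemma norm_endo_eq_onorm: "norm f = onorm (endo_apply f)"
  by (simp add: endo_apply_def norm_endo.rep_eq norm_blinfun.rep_eq)

lemma bounded_linear_endo_apply: "bounded_linear (\<lambda>f. endo_apply f v)"
proof (rule bounded_linear_intro)
  show "endo_apply (f + g) v = endo_apply f v + endo_apply g v"
    "endo_apply (r *\<^sub>R f) v = r *\<^sub>R endo_apply f v" for f g :: "'a endo" and r
    by (simp_all add: endo_apply_def plus_endo.rep_eq scaleR_endo.rep_eq blinfun.bilinear_simps)
  show "norm (endo_apply f v) \<le> norm f * norm v" for f :: "'a endo"
    by (simp add: endo_apply_def norm_endo.rep_eq norm_blinfun)
qed

text \<open>A skew-symmetric operator preserves the norm of the solutions of \<open>v' = X v\<close>.\<close>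

lemma norm_exp_skew_le_1:
  fixes X :: "'a::euclidean_space endo"
  assumes skew: "\<And>v. v \<bullet> endo_apply X v = 0"
  shows "norm (exp (t *\<^sub>R X)) \<le> 1"
proof -
  have "norm (endo_apply (exp (t *\<^sub>R X)) v) = norm v" for v
  proof -
    define f where "f s = endo_apply (exp (s *\<^sub>R X)) v" for s
    have f': "(f has_vector_derivative endo_apply X (f s)) (at s)" for s
      unfolding f_def endo_apply_mult[symmetric]
      by (rule bounded_linear.has_vector_derivative[OF bounded_linear_endo_apply
            exp_scaleR_has_vector_derivative_left])
    have "((\<lambda>s. f s \<bullet> f s) has_vector_derivative f s \<bullet> endo_apply X (f s) + endo_apply X (f s) \<bullet> f s) (at s)"
      for s
      by (rule bounded_bilinear.has_vector_derivative[OF bounded_bilinear_inner f' f'])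
    then have "DERIV (\<lambda>s. f s \<bullet> f s) s :> 0" for s
      by (simp add: has_real_derivative_iff_has_vector_derivative skew inner_commute)
    then have "f t \<bullet> f t = f 0 \<bullet> f 0"
      by (intro DERIV_isconst_all) blast
    moreover have "f 0 = v"
      by (simp add: f_def endo_apply_def one_endo.rep_eq)
    ultimately show ?thesis
      by (simp add: f_def norm_eq_sqrt_inner)
  qed
  then show ?thesis
    unfolding norm_endo.rep_eq by (intro norm_blinfun_bound) (simp_all add: endo_apply_def)
qed


section \<open>The Trotter error for matrices\<close>

text \<open>The bridge to the abstract estimate. The target is a real algebra, so the imaginary unit
  is always multiplied into the matrix before this map is applied.\<close>

definition endo_of_matrix :: "complex ^ 'n ^ 'n \<Rightarrow> (complex ^ 'n) endo"
  where "endo_of_matrix A = Abs_endo (Blinfun ((*v) A))"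

lemma endo_apply_of_matrix [simp]: "endo_apply (endo_of_matrix A) v = A *v v"
  by (simp add: endo_apply_def endo_of_matrix_def Abs_endo_inverse bounded_linear_Blinfun_apply)

lemma norm_endo_of_matrix: "norm (endo_of_matrix A) = opnorm A"
  unfolding norm_endo_eq_onorm opnorm_def endo_apply_of_matrix ..

lemma linear_endo_of_matrix: "linear endo_of_matrix"
proof (rule linearI; rule endo_eqI)
  fix A B :: "complex ^ 'n ^ 'n" and r :: real and v
  show "endo_apply (endo_of_matrix (A + B)) v = endo_apply (endo_of_matrix A + endo_of_matrix B) v"
    by (simp add: linear_add[OF bounded_linear.linear[OF bounded_linear_endo_apply]]
        matrix_vector_mult_add_rdistrib)
  show "endo_apply (endo_of_matrix (r *\<^sub>R A)) v = endo_apply (r *\<^sub>R endo_of_matrix A) v"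
    by (simp add: linear_cmul[OF bounded_linear.linear[OF bounded_linear_endo_apply]]
        matrix_vector_mult_def vec_eq_iff scaleR_sum_right)
qed

lemmas endo_of_matrix_add = linear_add[OF linear_endo_of_matrix]
  and endo_of_matrix_diff = linear_diff[OF linear_endo_of_matrix]
  and endo_of_matrix_neg = linear_neg[OF linear_endo_of_matrix]
  and endo_of_matrix_scaleR = linear_cmul[OF linear_endo_of_matrix]

lemma endo_of_matrix_mult: "endo_of_matrix (A ** B) = endo_of_matrix A * endo_of_matrix B"
  by (rule endo_eqI) (simp add: endo_apply_mult matrix_vector_mul_assoc)

lemma endo_of_matrix_1: "endo_of_matrix (mat 1) = 1"
  by (rule endo_eqI) (simp add: endo_apply_def[of 1] one_endo.rep_eq)

lemma endo_of_matrix_power: "endo_of_matrix (((**) A ^^ k) (mat 1)) = endo_of_matrix A ^ k"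
  by (induction k) (simp_all add: endo_of_matrix_1 endo_of_matrix_mult)

section \<open>Convergence and transfer of the matrix exponential\<close>

lemma matrix_mult_add_right: "(A + B) ** C = A ** C + B ** (C :: 'a::semiring_1 ^ 'n ^ 'm)"
  by (simp add: matrix_matrix_mult_def vec_eq_iff algebra_simps sum.distrib)

lemma bounded_bilinear_matrix_mult:
  "bounded_bilinear ((**) :: complex ^ 'n ^ 'n \<Rightarrow> complex ^ 'n ^ 'n \<Rightarrow> complex ^ 'n ^ 'n)"
proof (rule iffD1[OF bilinear_conv_bounded_bilinear])
  show "bilinear ((**) :: complex ^ 'n ^ 'n \<Rightarrow> complex ^ 'n ^ 'n \<Rightarrow> complex ^ 'n ^ 'n)"
    unfolding bilinear_def
    by (intro conjI allI linearI)
      (simp_all add: matrix_add_ldistrib matrix_mult_add_right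
        matrix_scalar_ac scalar_matrix_assoc)
qed

text \<open>The product \<open>**\<close> is bounded for the Euclidean norm of matrices up to some
  factor \<open>K\<close>; absorbing \<open>K\<close> into the base of the power still leaves an
  exponential series as majorant. Summability is what allows the series to be pushed through
  \<open>endo_of_matrix\<close>.\<close>

lemma summable_mexp:
  fixes A :: "complex ^ 'n ^ 'n"
  shows "summable (\<lambda>k. (1 / fact k) *\<^sub>R (((**) A ^^ k) (mat 1)))"
proof -
  obtain K where K: "\<And>(B :: complex ^ 'n ^ 'n) (C :: complex ^ 'n ^ 'n). norm (B ** C) \<le> norm B * norm C * K" "K > 0"
    using bounded_bilinear.pos_bounded[OF bounded_bilinear_matrix_mult] by blast
  have pow: "norm (((**) A ^^ k) (mat 1)) \<le> (norm A * K) ^ k * norm (mat 1 :: complex ^ 'n ^ 'n)" for k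
  proof (induction k)
    case (Suc k)
    have "norm (((**) A ^^ Suc k) (mat 1)) \<le> norm A * K * norm (((**) A ^^ k) (mat 1))"
      using K(1)[of A "((**) A ^^ k) (mat 1)"] by (simp add: mult_ac)
    also have "\<dots> \<le> norm A * K * ((norm A * K) ^ k * norm (mat 1 :: complex ^ 'n ^ 'n))"
      using Suc K(2) by (intro mult_left_mono) auto
    finally show ?case by (simp add: mult_ac)
  qed simp
  show ?thesis
  proof (rule summable_comparison_test')
    show "summable (\<lambda>k. inverse (fact k) * (norm A * K) ^ k * norm (mat 1 :: complex ^ 'n ^ 'n))"
      by (intro summable_mult2 summable_exp)
    show "norm ((1 / fact k) *\<^sub>R (((**) A ^^ k) (mat 1)))
      \<le> inverse (fact k) * (norm A * K) ^ k * norm (mat 1 :: complex ^ 'n ^ 'n)" if "0 \<le> k" for k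
      using mult_left_mono[OF pow[of k], of "inverse (fact k)"]
      by (simp add: divide_inverse mult.assoc)
  qed
qed

lemma endo_of_matrix_mexp: "endo_of_matrix (mexp A) = exp (endo_of_matrix A)"
proof -
  have "bounded_linear (endo_of_matrix :: complex ^ 'n ^ 'n \<Rightarrow> _)"
    using linear_endo_of_matrix linear_conv_bounded_linear by blast
  from bounded_linear.suminf[OF this summable_mexp[of A]] show ?thesis
    unfolding mexp_def exp_def
    by (simp add: endo_of_matrix_scaleR endo_of_matrix_power divide_inverse)
qed

lemma opnorm_nonneg: "0 \<le> opnorm (A :: complex ^ 'n ^ 'n)"
  by (simp flip: norm_endo_of_matrix)

lemma opnorm_mult_le: "opnorm (A ** B) \<le> opnorm (A :: complex ^ 'n ^ 'n) * opnorm (B :: complex ^ 'n ^ 'n)"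
  unfolding norm_endo_of_matrix[symmetric] endo_of_matrix_mult by (rule norm_mult_ineq)

lemma opnorm_minus [simp]: "opnorm (- A) = opnorm (A :: complex ^ 'n ^ 'n)"
  by (simp add: endo_of_matrix_neg flip: norm_endo_of_matrix)

lemma opnorm_diff_triangle:
  "opnorm (A - C) \<le> opnorm (A - B) + opnorm (B - C :: complex ^ 'n ^ 'n)"
  using norm_triangle_ineq[of "endo_of_matrix (A - B)" "endo_of_matrix (B - C)"]
  by (simp add: norm_endo_of_matrix flip: endo_of_matrix_add)

lemma opnorm_cscale_imaginary_unit [simp]: "opnorm (\<i> *\<^sub>C A) = opnorm (A :: complex ^ 'n ^ 'n)"
proof -
  have "norm ((\<i> *\<^sub>C A) *v v) = norm (A *v v)" for v
    by (simp add: norm_vec_def cscale_def matrix_vector_mult_def mult.assoc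
        norm_mult flip: sum_distrib_left)
  then show ?thesis
    by (simp add: opnorm_def onorm_def)
qed

lemma cscale_of_real: "(c * complex_of_real t) *\<^sub>C A = t *\<^sub>R (c *\<^sub>C A)"
  by (simp add: cscale_def vec_eq_iff scaleR_conv_of_real[where 'a = complex] mult_ac)

lemma cscale_add: "c *\<^sub>C (A + B) = c *\<^sub>C A + c *\<^sub>C B"
  by (simp add: cscale_def vec_eq_iff algebra_simps)

lemma cscale_diff: "c *\<^sub>C (A - B) = c *\<^sub>C A - c *\<^sub>C B"
  by (simp add: cscale_def vec_eq_iff algebra_simps)

lemma cscale_mult_left: "(c *\<^sub>C A) ** B = c *\<^sub>C (A ** B)"
  by (simp add: cscale_def matrix_matrix_mult_def vec_eq_iff sum_distrib_left mult_ac)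

lemma cscale_mult_right: "A ** (c *\<^sub>C B) = c *\<^sub>C (A ** B)"
  by (simp add: cscale_def matrix_matrix_mult_def vec_eq_iff sum_distrib_left mult_ac)

lemma cscale_imaginary_unit_twice: "\<i> *\<^sub>C \<i> *\<^sub>C A = - A"
  by (simp add: cscale_def vec_eq_iff flip: mult.assoc)

section \<open>Adjoints and Hermitian generators\<close>

lemma dagger_add: "dagger (A + B) = dagger A + dagger B"
  by (simp add: dagger_def vec_eq_iff)

lemma dagger_diff: "dagger (A - B) = dagger A - dagger B"
  by (simp add: dagger_def vec_eq_iff)

lemma dagger_scaleR: "dagger (r *\<^sub>R A) = r *\<^sub>R dagger A"
  by (simp add: dagger_def vec_eq_iff)

lemma dagger_sum: "dagger (\<Sum>x\<in>S. f x) = (\<Sum>x\<in>S. dagger (f x))"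
  by (simp add: dagger_def vec_eq_iff)

lemma dagger_mult: "dagger (A ** B) = dagger B ** dagger A"
  by (simp add: dagger_def matrix_matrix_mult_def vec_eq_iff mult.commute)

lemma dagger_dagger [simp]: "dagger (dagger A) = A"
  by (simp add: dagger_def vec_eq_iff)

lemma dagger_mat_1 [simp]: "dagger (mat 1) = mat 1"
  by (simp add: dagger_def mat_def vec_eq_iff)

text \<open>The real inner product on complex vectors is the real part of the Hermitian one, so the
  conjugate transpose is also the adjoint in the real sense.\<close>

lemma inner_matrix_vector_mult: "v \<bullet> (A *v w) = (dagger A *v v) \<bullet> w"
proof -
  have inner_complex: "x \<bullet> y = Re (cnj x * y)" for x y :: complex
    by (simp add: inner_complex_def)
  have "v \<bullet> (A *v w) = (\<Sum>i\<in>UNIV. \<Sum>j\<in>UNIV. Re (cnj (v $ i) * (A $ i $ j * w $ j)))"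
    by (simp add: inner_vec_def inner_complex matrix_vector_mult_def sum_distrib_left
        del: times_complex.sel)
  also have "\<dots> = (\<Sum>j\<in>UNIV. \<Sum>i\<in>UNIV. Re (cnj (v $ i) * (A $ i $ j * w $ j)))"
    by (rule sum.swap)
  also have "\<dots> = (dagger A *v v) \<bullet> w"
    by (simp add: inner_vec_def inner_complex matrix_vector_mult_def dagger_def
        sum_distrib_left sum_distrib_right mult_ac del: times_complex.sel)
  finally show ?thesis .
qed

lemma norm_exp_imaginary_hermitian:
  assumes "dagger A = A"
  shows "norm (exp (t *\<^sub>R endo_of_matrix (\<i> *\<^sub>C A))) \<le> 1"
proof (rule norm_exp_skew_le_1)
  fix v
  have "dagger (\<i> *\<^sub>C A) = - (\<i> *\<^sub>C A)"
  proof -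
    have "dagger (\<i> *\<^sub>C A) = - (\<i> *\<^sub>C dagger A)"
      by (simp add: dagger_def cscale_def vec_eq_iff)
    then show ?thesis using assms by simp
  qed
  \<comment> \<open>The real inner product is symmetric, so the quantity equals its own negative and
    vanishes.\<close>
  then have "v \<bullet> ((\<i> *\<^sub>C A) *v v) = (- (\<i> *\<^sub>C A) *v v) \<bullet> v"
    by (simp add: inner_matrix_vector_mult[of v])
  also have "\<dots> = - (v \<bullet> ((\<i> *\<^sub>C A) *v v))"
    by (simp add: matrix_vector_mult_def inner_vec_def sum_negf inner_commute)
  finally show "v \<bullet> endo_apply (endo_of_matrix (\<i> *\<^sub>C A)) v = 0" by simp
qed

lemma opnorm_mexp_hermitian_le_1:
  assumes "dagger A = A"
  shows "opnorm (mexp ((\<i> * complex_of_real t) *\<^sub>C A)) \<le> 1"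
  using norm_exp_imaginary_hermitian[OF assms]
  by (simp add: cscale_of_real endo_of_matrix_mexp endo_of_matrix_scaleR flip: norm_endo_of_matrix)

lemma strang_splitting_error_hermitian:
  assumes "dagger A = A" "dagger B = B" "0 \<le> t"
  shows "opnorm (mexp ((\<i> * complex_of_real t) *\<^sub>C (A + B))
      - mexp ((\<i> * complex_of_real (t/2)) *\<^sub>C A) ** mexp ((\<i> * complex_of_real t) *\<^sub>C B)
        ** mexp ((\<i> * complex_of_real (t/2)) *\<^sub>C A))
    \<le> (1/12 * opnorm (comm (comm A B) B) + 1/24 * opnorm (comm (comm A B) A)) * t ^ 3"
proof -
  define X Y where "X = endo_of_matrix (\<i> *\<^sub>C A)" and "Y = endo_of_matrix (\<i> *\<^sub>C B)"
  have XY: "X + Y = endo_of_matrix (\<i> *\<^sub>C (A + B))"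
    by (simp add: X_def Y_def cscale_add endo_of_matrix_add)
  have "X * Y - Y * X = endo_of_matrix (- comm A B)" "Y * X - X * Y = endo_of_matrix (comm A B)"
    by (simp_all add: X_def Y_def comm_def cscale_mult_left cscale_mult_right
        cscale_imaginary_unit_twice flip: endo_of_matrix_mult endo_of_matrix_diff)
  \<comment> \<open>Three factors of the imaginary unit and the reversed orderings leave only a
    scalar of modulus one in front of each double commutator, which the operator norm does not
    see.\<close>
  moreover have "Y * endo_of_matrix C - endo_of_matrix C * Y = endo_of_matrix (- (\<i> *\<^sub>C comm C B))"
    "X * endo_of_matrix (- C) - endo_of_matrix (- C) * X = endo_of_matrix (\<i> *\<^sub>C comm C A)" for C
    by (simp_all add: X_def Y_def comm_def cscale_mult_left cscale_mult_right cscale_diff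
        endo_of_matrix_neg endo_of_matrix_diff endo_of_matrix_mult flip: endo_of_matrix_mult)
  ultimately have
    "norm (Y * (Y * X - X * Y) - (Y * X - X * Y) * Y) = opnorm (comm (comm A B) B)"
    "norm (X * (X * Y - Y * X) - (X * Y - Y * X) * X) = opnorm (comm (comm A B) A)"
    by (simp_all add: norm_endo_of_matrix)
  moreover have "norm (exp (t *\<^sub>R (X + Y)) - exp ((t/2) *\<^sub>R X) * exp (t *\<^sub>R Y) * exp ((t/2) *\<^sub>R X))
    \<le> (1/12 * norm (Y * (Y * X - X * Y) - (Y * X - X * Y) * Y)
       + 1/24 * norm (X * (X * Y - Y * X) - (X * Y - Y * X) * X)) * t ^ 3"
  proof (rule strang_splitting_error)
    show "norm (exp (s *\<^sub>R (X + Y))) \<le> 1" for s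
      unfolding XY by (rule norm_exp_imaginary_hermitian) (simp add: dagger_add assms)
  qed (simp_all add: X_def Y_def norm_exp_imaginary_hermitian assms)
  ultimately show ?thesis
    unfolding norm_endo_of_matrix[symmetric] XY
    by (simp only: X_def Y_def cscale_of_real endo_of_matrix_diff endo_of_matrix_mult
        endo_of_matrix_mexp endo_of_matrix_scaleR)
qed


section \<open>Permutations of the modes\<close>

definition inversions :: "('m::finite \<Rightarrow> 'm) \<Rightarrow> 'm set \<Rightarrow> ('m \<times> 'm) set"
  where "inversions p S = {(a, b) \<in> S \<times> S. to_nat a < to_nat b \<and> to_nat (p b) < to_nat (p a)}"

text \<open>
  The sign of reordering the occupied modes compensates the change of the Jordan--Wigner signs under
  relabelling, so that conjugation with \<open>perm_op p\<close> maps the mode \<open>m\<close> to \<open>p m\<close>.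
\<close>

definition perm_op :: "('m::finite \<Rightarrow> 'm) \<Rightarrow> 'm fock_op"
  where "perm_op p = (\<chi> T S. if T = p ` S then (-1) ^ card (inversions p S) else 0)"

text \<open>Deleting \<open>m\<close> destroys exactly the inversions that involve \<open>m\<close>:
  pairs \<open>(a, m)\<close> with \<open>a\<close> in \<open>L - L'\<close> and pairs
  \<open>(m, b)\<close> with \<open>b\<close> in \<open>L' - L\<close>. Their number has the parity
  of \<open>card L + card L'\<close>, and these two cardinalities are the exponents of the two
  Jordan-Wigner signs.\<close>

lemma jw_sign_perm:
  fixes p :: "'m::finite \<Rightarrow> 'm"
  assumes "inj p" "m \<in> S"
  shows "(-1) ^ card (inversions p (S - {m})) * jw_sign m S
    = jw_sign (p m) (p ` S) * (-1) ^ card (inversions p S)"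
proof -
  define L where "L = {k \<in> S. to_nat k < to_nat m}"
  define L' where "L' = {k \<in> S. to_nat (p k) < to_nat (p m)}"
  have ne: "to_nat (p k) < to_nat (p m) \<or> to_nat (p m) < to_nat (p k)"
    "to_nat k < to_nat m \<or> to_nat m < to_nat k" if "k \<noteq> m" for k
    using that \<open>inj p\<close> by (metis inj_eq linorder_neqE_nat to_nat_split)+
  have split: "inversions p S = (inversions p (S - {m}) \<union> (\<lambda>a. (a, m)) ` (L - L')) \<union> Pair m ` (L' - L)"
    using \<open>m \<in> S\<close> ne by (fastforce simp: inversions_def L_def L'_def)
  have "card (inversions p S) = card (inversions p (S - {m})) + card (L - L') + card (L' - L)"
    unfolding split
  proof (subst card_Un_disjoint; (subst card_Un_disjoint)?)
    show "card (inversions p (S - {m})) + card ((\<lambda>a. (a, m)) ` (L - L')) + card (Pair m ` (L' - L))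
      = card (inversions p (S - {m})) + card (L - L') + card (L' - L)"
      by (simp add: card_image inj_on_def)
  qed (auto simp: inversions_def L_def L'_def)
  moreover have "card L = card (L \<inter> L') + card (L - L')"
    by (metis card_Int_Diff finite)
  moreover have "card L' = card (L \<inter> L') + card (L' - L)"
    by (metis Int_commute card_Int_Diff finite)
  ultimately have "even (card (inversions p (S - {m})) + card L) \<longleftrightarrow> even (card L' + card (inversions p S))"
    by presburger
  then have "(-1 :: complex) ^ (card (inversions p (S - {m})) + card L)
    = (-1) ^ (card L' + card (inversions p S))"
    by (simp only: minus_one_power_iff)
  moreover have "{k \<in> p ` S. to_nat k < to_nat (p m)} = p ` L'"
    by (auto simp: L'_def)
  then have "card {k \<in> p ` S. to_nat k < to_nat (p m)} = card L'"
    using \<open>inj p\<close> by (simp add: card_image inj_on_subset)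
  ultimately show ?thesis
    by (simp add: jw_sign_def L_def power_add)
qed

lemma perm_op_annih:
  assumes "inj p"
  shows "perm_op p ** annih m = annih (p m) ** perm_op p"
proof -
  have "(perm_op p ** annih m) $ T $ S = (annih (p m) ** perm_op p) $ T $ S" for T S
  proof -
    have "(perm_op p ** annih m) $ T $ S = (\<Sum>R\<in>UNIV. perm_op p $ T $ R * annih m $ R $ S)"
      by (simp add: matrix_matrix_mult_def)
    also have "\<dots> = perm_op p $ T $ (S - {m}) * annih m $ (S - {m}) $ S"
      by (rule sum_UNIV_single) (simp add: annih_def)
    also have "\<dots> = annih (p m) $ T $ (p ` S) * perm_op p $ (p ` S) $ S"
      using jw_sign_perm[OF assms, of m S]
      by (auto simp: perm_op_def annih_def image_set_diff[OF assms] inj_image_mem_iff[OF assms])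
    also have "\<dots> = (\<Sum>R\<in>UNIV. annih (p m) $ T $ R * perm_op p $ R $ S)"
      by (rule sum_UNIV_single[symmetric]) (simp add: perm_op_def)
    also have "\<dots> = (annih (p m) ** perm_op p) $ T $ S"
      by (simp add: matrix_matrix_mult_def)
    finally show ?thesis .
  qed
  then show ?thesis by (simp add: vec_eq_iff)
qed

lemma dagger_perm_op_perm_op:
  assumes "inj p"
  shows "dagger (perm_op p) ** perm_op p = mat 1"
proof -
  have "(dagger (perm_op p) ** perm_op p) $ T $ S = mat 1 $ T $ S" for T S
  proof -
    have "(dagger (perm_op p) ** perm_op p) $ T $ S
      = (\<Sum>R\<in>UNIV. dagger (perm_op p) $ T $ R * perm_op p $ R $ S)"
      by (simp add: matrix_matrix_mult_def)
    also have "\<dots> = dagger (perm_op p) $ T $ (p ` S) * perm_op p $ (p ` S) $ S"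
      by (rule sum_UNIV_single) (simp add: perm_op_def)
    also have "\<dots> = mat 1 $ T $ S"
      using inj_image_eq_iff[OF assms, of S T]
      by (auto simp: perm_op_def dagger_def mat_def simp flip: power_mult_distrib)
    finally show ?thesis .
  qed
  then show ?thesis by (simp add: vec_eq_iff)
qed

lemma perm_op_dagger_perm_op: "inj p \<Longrightarrow> perm_op p ** dagger (perm_op p) = mat 1"
  using dagger_perm_op_perm_op matrix_left_right_inverse by blast

lemma perm_op_creat:
  assumes "inj p"
  shows "perm_op p ** creat m = creat (p m) ** perm_op p"
proof -
  let ?U = "perm_op p"
  have "?U ** creat m = ?U ** (creat m ** dagger ?U) ** ?U"
    by (simp add: dagger_perm_op_perm_op[OF assms] flip: matrix_mul_assoc)
  \<comment> \<open>The adjoint of the relation for annihilation operators; multiplying by the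
    unitary on both sides restores the required order.\<close>
  also have "creat m ** dagger ?U = dagger ?U ** creat (p m)"
    using arg_cong[OF perm_op_annih[OF assms, of m], of dagger] by (simp add: dagger_mult)
  finally show ?thesis
    by (simp add: perm_op_dagger_perm_op[OF assms] matrix_mul_assoc)
qed

section \<open>Operator norms under unitary intertwiners\<close>

lemma opnorm_le_1_if_isometry:
  fixes U :: "complex ^ 'n ^ 'n"
  assumes "dagger U ** U = mat 1"
  shows "opnorm U \<le> 1"
proof -
  have "norm (U *v v) \<le> 1 * norm v" for v
  proof -
    have "(U *v v) \<bullet> (U *v v) = v \<bullet> v"
      using assms by (simp add: inner_matrix_vector_mult matrix_vector_mul_assoc)
    then show ?thesis by (simp add: norm_eq_sqrt_inner)
  qed
  then show ?thesis unfolding opnorm_def by (rule onorm_le)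
qed

lemma opnorm_mult_contractions_le:
  fixes U A V :: "complex ^ 'n ^ 'n"
  assumes "opnorm U \<le> 1" "opnorm V \<le> 1"
  shows "opnorm (U ** A ** V) \<le> opnorm A"
proof -
  have "opnorm (U ** A ** V) \<le> opnorm U * opnorm A * opnorm V"
    by (rule order_trans[OF opnorm_mult_le mult_right_mono[OF opnorm_mult_le opnorm_nonneg]])
  also have "\<dots> \<le> 1 * opnorm A * 1"
    using assms by (intro mult_mono) (simp_all add: opnorm_nonneg)
  finally show ?thesis by simp
qed

text \<open>In finite dimension the isometry \<open>U\<close> is unitary, so A is
  \<open>dagger U ** B ** U\<close> and both outer factors are contractions.\<close>

lemma opnorm_intertwined_le:
  fixes U :: "complex ^ 'n ^ 'n"
  assumes U: "dagger U ** U = mat 1" and "U ** A = B ** U"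
  shows "opnorm A \<le> opnorm B"
proof -
  have U': "U ** dagger U = mat 1" using U matrix_left_right_inverse by blast
  have "A = dagger U ** B ** U"
    using assms by (metis matrix_mul_assoc matrix_mul_lid)
  then show ?thesis
    using opnorm_le_1_if_isometry[OF U] opnorm_le_1_if_isometry[of "dagger U"] U'
    by (simp add: opnorm_mult_contractions_le)
qed

lemma matrix_mult_diff_left: "A ** (B - C) = A ** B - A ** (C :: 'a::ring_1 ^ 'n ^ 'm)"
  by (simp add: matrix_matrix_mult_def vec_eq_iff algebra_simps sum_subtractf)

lemma matrix_mult_diff_right: "(A - B) ** C = A ** C - B ** (C :: 'a::ring_1 ^ 'n ^ 'm)"
  by (simp add: matrix_matrix_mult_def vec_eq_iff algebra_simps sum_subtractf)

lemma comm_intertwined: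
  assumes "U ** A = A' ** U" "U ** B = B' ** U"
  shows "U ** comm A B = comm A' B' ** U"
proof -
  have "U ** (A ** B) = A' ** B' ** U" "U ** (B ** A) = B' ** A' ** U"
    using assms by (metis matrix_mul_assoc)+
  then show ?thesis
    by (simp add: comm_def matrix_mult_diff_left matrix_mult_diff_right)
qed


section \<open>The Hubbard model\<close>

lemma dagger_z_op: "dagger (z_op m) = z_op m"
proof -
  have "dagger (2 *\<^sub>C A) = 2 *\<^sub>C dagger A" for A :: "'a fock_op"
    by (simp add: dagger_def cscale_def vec_eq_iff)
  then show ?thesis
    by (simp add: z_op_def number_op_def dagger_diff dagger_mult)
qed

lemma z_op_entry: "z_op m $ T $ S = (if T = S then if m \<in> S then 1 else -1 else 0)"
  by (auto simp: z_op_def number_op_def creat_annih_entry cscale_def mat_def insert_absorb)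

lemma z_op_commute: "z_op m ** z_op n = z_op n ** z_op m"
proof -
  have "(z_op m ** z_op n) $ T $ S = z_op m $ T $ S * z_op n $ S $ S" for m n :: 'a and T S
    unfolding matrix_matrix_mult_def
    by simp (rule sum_UNIV_single, simp add: z_op_entry)
  then show ?thesis by (simp add: vec_eq_iff z_op_entry)
qed

text \<open>Taking adjoints reverses the two z factors; being diagonal, they commute.\<close>

lemma dagger_H_int: "dagger (H_int u) = H_int u"
  by (simp add: H_int_def dagger_scaleR dagger_sum dagger_mult dagger_z_op z_op_commute)

lemma dagger_hop_term: "dagger (hop_term \<sigma> e) = hop_term \<sigma> e"
proof -
  have "dagger (hop_term \<sigma> e) = (\<Sum>(i, j)\<in>{(i, j). {i, j} = e}. creat (j, \<sigma>) ** annih (i, \<sigma>))"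
    by (simp add: hop_term_def dagger_sum case_prod_unfold dagger_mult)
  also have "\<dots> = hop_term \<sigma> e"
    unfolding hop_term_def
    by (rule sum.reindex_bij_witness[where i = prod.swap and j = prod.swap]) (auto simp: insert_commute)
  finally show ?thesis .
qed

lemma dagger_hopping_on: "dagger (hopping_on E \<tau>) = hopping_on E \<tau>"
  by (simp add: hopping_on_def dagger_scaleR dagger_sum dagger_hop_term)

section \<open>The diagonal translation and its unitary\<close>

definition diag_shift :: "'l::nontriv site \<Rightarrow> 'l site"
  where "diag_shift i = i + (1, 1)"

definition shift_op :: "'l::nontriv hubbard_op"
  where "shift_op = perm_op (map_prod diag_shift id)"

lemma inj_diag_shift: "inj diag_shift"
  by (simp add: diag_shift_def inj_def)

lemma inj_mode_shift: "inj (map_prod diag_shift id)"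
  by (simp add: inj_diag_shift prod.inj_map)

lemma matrix_mult_sum_left: "A ** (\<Sum>x\<in>S. f x) = (\<Sum>x\<in>S. A ** f x)"
  by (induction S rule: infinite_finite_induct) (simp_all add: matrix_add_ldistrib)

lemma matrix_mult_sum_right: "(\<Sum>x\<in>S. f x) ** A = (\<Sum>x\<in>S. f x ** A)"
  by (induction S rule: infinite_finite_induct) (simp_all add: matrix_mult_add_right)

lemma shift_op_hop_term:
  fixes e :: "'l::nontriv site set"
  shows "shift_op ** hop_term \<sigma> e = hop_term \<sigma> (diag_shift ` e) ** shift_op"
proof -
  have "shift_op ** (creat (i, \<sigma>) ** annih (j, \<sigma>))
    = creat (diag_shift i, \<sigma>) ** annih (diag_shift j, \<sigma>) ** shift_op" for i j :: "'l site"
  proof -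
    have "shift_op ** (creat (i, \<sigma>) ** annih (j, \<sigma>)) = (shift_op ** creat (i, \<sigma>)) ** annih (j, \<sigma>)"
      by (rule matrix_mul_assoc)
    also have "\<dots> = creat (diag_shift i, \<sigma>) ** (shift_op ** annih (j, \<sigma>))"
      by (simp add: shift_op_def perm_op_creat[OF inj_mode_shift] flip: matrix_mul_assoc)
    also have "\<dots> = creat (diag_shift i, \<sigma>) ** annih (diag_shift j, \<sigma>) ** shift_op"
      by (simp add: shift_op_def perm_op_annih[OF inj_mode_shift] matrix_mul_assoc)
    finally show ?thesis .
  qed
  then have "shift_op ** hop_term \<sigma> e = (\<Sum>(i, j)\<in>{(i, j). {i, j} = e}.
      creat (diag_shift i, \<sigma>) ** annih (diag_shift j, \<sigma>) ** shift_op)"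
    by (simp add: hop_term_def matrix_mult_sum_left case_prod_unfold)
  \<comment> \<open>The orderings of the edge \<open>e\<close> correspond bijectively to those of
    its translate.\<close>
  also have "\<dots> = (\<Sum>(i, j)\<in>{(i, j). {i, j} = diag_shift ` e}. creat (i, \<sigma>) ** annih (j, \<sigma>) ** shift_op)"
  proof (rule sum.reindex_bij_witness[where j = "map_prod diag_shift diag_shift"
        and i = "map_prod (\<lambda>i. i - (1, 1)) (\<lambda>i. i - (1, 1))"])
    fix a :: "'l site \<times> 'l site"
    assume "a \<in> {(i, j). {i, j} = diag_shift ` e}"
    then have "(\<lambda>i. i - (1, 1)) ` {fst a, snd a} = (\<lambda>i. i - (1, 1)) ` diag_shift ` e"
      by (auto simp: case_prod_unfold)
    then show "map_prod (\<lambda>i. i - (1, 1)) (\<lambda>i. i - (1, 1)) a \<in> {(i, j). {i, j} = e}"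
      by (cases a) (simp add: image_image diag_shift_def)
  qed (auto simp: diag_shift_def)
  also have "\<dots> = hop_term \<sigma> (diag_shift ` e) ** shift_op"
    by (simp add: hop_term_def matrix_mult_sum_right case_prod_unfold)
  finally show ?thesis .
qed

lemma shift_op_hopping_on:
  "shift_op ** hopping_on E \<tau> = hopping_on ((`) diag_shift ` E) \<tau> ** shift_op"
proof -
  have "inj_on ((`) diag_shift) E"
    by (meson inj_diag_shift inj_image_eq_iff inj_onI)
  then show ?thesis
    by (simp add: hopping_on_def matrix_mult_sum_left matrix_mult_sum_right shift_op_hop_term
        matrix_scalar_ac sum.reindex scaleR_sum_right flip: scalar_matrix_assoc)
qed

section \<open>Plaquette colours, their exchange, and the partition of the edges\<close>

lemma diag_shift_plaquette_edges:
  "(`) diag_shift ` plaquette_edges (x, y) = plaquette_edges (x + 1, y + 1 :: 'l::nontriv mod_ring)"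
  by (simp add: plaquette_edges_def diag_shift_def)

lemma diag_shift_Union_plaquette_edges:
  "(`) diag_shift ` \<Union>{plaquette_edges (x, y) |x y. P x \<and> P y}
    = \<Union>{plaquette_edges (x, y :: 'l::nontriv mod_ring) |x y. P (x - 1) \<and> P (y - 1)}"
proof -
  have "(`) diag_shift ` \<Union>{plaquette_edges (x, y) |x y. P x \<and> P y}
    = \<Union>{plaquette_edges (x + 1, y + 1 :: 'l mod_ring) |x y. P x \<and> P y}"
    unfolding image_Union by (auto simp flip: diag_shift_plaquette_edges)
  also have "{plaquette_edges (x + 1, y + 1 :: 'l mod_ring) |x y. P x \<and> P y}
    = {plaquette_edges (x, y) |x y. P (x - 1) \<and> P (y - 1)}"
    by (rule Collect_cong) (metis add_diff_cancel_right' diff_add_cancel)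
  finally show ?thesis .
qed

text \<open>Membership depends only on the starting coordinate along the direction of the edge. The
  transverse coordinate is free because of alternation: if \<open>P y\<close> holds, the horizontal
  edge is the bottom of the plaquette at \<open>(x, y)\<close>; otherwise \<open>P (y - 1)\<close>
  holds and it is the top of the plaquette at \<open>(x, y - 1)\<close>. With \<open>P\<close> as
  even or odd parity this describes the pink and the gold edges.\<close>

lemma Union_plaquette_edges_iff:
  fixes P :: "'l::nontriv mod_ring \<Rightarrow> bool"
  assumes alt: "\<And>x. P (x - 1) \<longleftrightarrow> \<not> P x"
  shows "e \<in> \<Union>{plaquette_edges (x, y) |x y. P x \<and> P y} \<longleftrightarrow>
    (\<exists>x y. P x \<and> e = {(x, y), (x + 1, y)}) \<or>
    (\<exists>x y. P y \<and> e = {(x, y), (x, y + 1)})"  (is "_ \<longleftrightarrow> ?h \<or> ?v")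
proof
  assume "e \<in> \<Union>{plaquette_edges (x, y) |x y. P x \<and> P y}"
  then show "?h \<or> ?v"
    unfolding plaquette_edges_def by (auto simp: insert_commute)
next
  have pl: "e \<in> \<Union>{plaquette_edges (x, y) |x y. P x \<and> P y}"
    if "P x" "P y" "e \<in> plaquette_edges (x, y)" for x y
    using that by blast
  assume "?h \<or> ?v"
  then show "e \<in> \<Union>{plaquette_edges (x, y) |x y. P x \<and> P y}"
  proof (elim disjE exE conjE)
    fix x y assume *: "P x" "e = {(x, y), (x + 1, y)}"
    show ?thesis
    proof (cases "P y")
      case True
      with * show ?thesis by (intro pl[of x y]) (auto simp: plaquette_edges_def)
    next
      case False
      with * show ?thesis
        by (intro pl[of x "y - 1"]) (auto simp: plaquette_edges_def alt)
    qed
  next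
    fix x y assume *: "P y" "e = {(x, y), (x, y + 1)}"
    show ?thesis
    proof (cases "P x")
      case True
      with * show ?thesis by (intro pl[of x y]) (auto simp: plaquette_edges_def)
    next
      case False
      with * show ?thesis
        by (intro pl[of "x - 1" y]) (auto simp: plaquette_edges_def alt)
    qed
  qed
qed

lemma edges_iff:
  "e \<in> (edges :: 'l::nontriv site set set) \<longleftrightarrow>
    (\<exists>x y. e = {(x, y), (x + 1, y)}) \<or> (\<exists>x y. e = {(x, y), (x, y + 1)})"
proof
  assume "e \<in> edges"
  then obtain i j where e: "e = {i, j}" and "j - i \<in> {(1, 0), (-1, 0), (0, 1), (0, -1)}"
    by (auto simp: edges_def nearest_def)
  then consider "j = i + (1, 0)" | "i = j + (1, 0)" | "j = i + (0, 1)" | "i = j + (0, 1)"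
    by (auto simp: prod_eq_iff algebra_simps)
  then show "(\<exists>x y. e = {(x, y), (x + 1, y)}) \<or> (\<exists>x y. e = {(x, y), (x, y + 1)})"
    by cases (cases i; cases j; force simp: e insert_commute)+
next
  assume "(\<exists>x y. e = {(x, y), (x + 1, y)}) \<or> (\<exists>x y. e = {(x, y), (x, y + 1)})"
  moreover have "nearest (x, y) (x + 1, y)" "nearest (x, y) (x, y + 1)" for x y :: "'l mod_ring"
    by (simp_all add: nearest_def)
  ultimately show "e \<in> edges" unfolding edges_def by blast
qed

context
  assumes even_card: "even CARD('l::nontriv)"
begin

text \<open>Reduction modulo an even L preserves parity; for odd L the step from L - 1 to 0 would
  break the alternation.\<close>

lemma even_to_int_mod_ring_add_1:
  "even (to_int_mod_ring (x + 1 :: 'l mod_ring)) \<longleftrightarrow> odd (to_int_mod_ring x)"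
proof -
  have "to_int_mod_ring (x + 1) = (to_int_mod_ring x + 1) mod int CARD('l)"
    by (simp add: to_int_mod_ring_add)
  moreover have "even (k mod int CARD('l)) \<longleftrightarrow> even k" for k
    using even_card by (simp add: dvd_mod_iff)
  ultimately show ?thesis by simp
qed

lemma even_to_int_mod_ring_diff_1:
  "even (to_int_mod_ring (x - 1 :: 'l mod_ring)) \<longleftrightarrow> odd (to_int_mod_ring x)"
  using even_to_int_mod_ring_add_1[of "x - 1"] by simp

lemma diag_shift_pink_edges: "(`) diag_shift ` pink_edges = (gold_edges :: 'l site set set)"
  unfolding pink_edges_def gold_edges_def diag_shift_Union_plaquette_edges
  by (simp add: even_to_int_mod_ring_diff_1)

lemma diag_shift_gold_edges: "(`) diag_shift ` gold_edges = (pink_edges :: 'l site set set)"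
  unfolding pink_edges_def gold_edges_def diag_shift_Union_plaquette_edges
  by (simp add: even_to_int_mod_ring_diff_1)

lemma pink_edges_iff:
  "e \<in> (pink_edges :: 'l site set set) \<longleftrightarrow>
    (\<exists>x y. even (to_int_mod_ring x) \<and> e = {(x, y), (x + 1, y)}) \<or>
    (\<exists>x y. even (to_int_mod_ring y) \<and> e = {(x, y), (x, y + 1)})"
  unfolding pink_edges_def
  by (rule Union_plaquette_edges_iff) (simp add: even_to_int_mod_ring_diff_1)

lemma gold_edges_iff:
  "e \<in> (gold_edges :: 'l site set set) \<longleftrightarrow>
    (\<exists>x y. odd (to_int_mod_ring x) \<and> e = {(x, y), (x + 1, y)}) \<or>
    (\<exists>x y. odd (to_int_mod_ring y) \<and> e = {(x, y), (x, y + 1)})"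
  unfolding gold_edges_def
  by (rule Union_plaquette_edges_iff) (simp add: even_to_int_mod_ring_diff_1)

lemma edges_eq_pink_gold: "(edges :: 'l site set set) = pink_edges \<union> gold_edges"
  unfolding set_eq_iff Un_iff edges_iff pink_edges_iff gold_edges_iff by blast

text \<open>An edge of both colours would start at an even coordinate in one description and at an
  odd one in the other, hence with its endpoints exchanged. That forces
  \<open>x + 1 + 1 = x\<close>, which fails for L >= 4.\<close>

lemma pink_gold_disjoint:
  assumes "CARD('l) \<ge> 4"
  shows "(pink_edges :: 'l site set set) \<inter> gold_edges = {}"
proof -
  have "to_int_mod_ring (1 + 1 :: 'l mod_ring) = 2"
    using assms unfolding to_int_mod_ring_add to_int_mod_ring_hom.hom_one by simp
  then have two: "(1 + 1 :: 'l mod_ring) \<noteq> 0" by force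
  have two': "x + 1 + 1 \<noteq> x" for x :: "'l mod_ring"
    using two by (simp add: add.assoc del: one_add_one)
  have "e \<notin> gold_edges" if "e \<in> pink_edges" for e :: "'l site set"
    using that two' unfolding pink_edges_iff gold_edges_iff
    by (auto simp: doubleton_eq_iff)
  then show ?thesis by blast
qed

lemma H_hop_eq_pink_gold:
  assumes "CARD('l) \<ge> 4"
  shows "(H_hop \<tau> :: 'l hubbard_op) = H_pink \<tau> + H_gold \<tau>"
  by (simp add: H_hop_def H_pink_def H_gold_def hopping_on_def edges_eq_pink_gold
      sum.union_disjoint pink_gold_disjoint[OF assms] sum.distrib scaleR_add_right)

lemma opnorm_comm_pink_le_gold:
  fixes \<tau> :: real
  defines "Hp \<equiv> H_pink \<tau> :: 'l hubbard_op" and "Hg \<equiv> H_gold \<tau> :: 'l hubbard_op"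
  shows "opnorm (comm (comm Hp Hg) Hp) \<le> opnorm (comm (comm Hp Hg) Hg)"
proof -
  have pg: "shift_op ** Hp = Hg ** shift_op" and gp: "shift_op ** Hg = Hp ** shift_op"
    by (simp_all add: Hp_def Hg_def H_pink_def H_gold_def shift_op_hopping_on
        diag_shift_pink_edges diag_shift_gold_edges)
  \<comment> \<open>The shift exchanges all three entries; restoring the order of the inner
    commutator afterwards costs only a sign.\<close>
  have "opnorm (comm (comm Hp Hg) Hp) \<le> opnorm (comm (comm Hg Hp) Hg)"
    by (rule opnorm_intertwined_le[OF _ comm_intertwined[OF comm_intertwined[OF pg gp] pg]])
      (simp add: shift_op_def dagger_perm_op_perm_op[OF inj_mode_shift])
  also have "comm (comm Hg Hp) Hg = - comm (comm Hp Hg) Hg"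
    by (simp add: comm_def matrix_mult_diff_left matrix_mult_diff_right)
  finally show ?thesis by simp
qed

end

theorem mainTheorem2:
  fixes u \<tau> :: real
    and H H\<^sub>I H\<^sub>h Hp Hg :: "'l::nontriv hubbard_op"
  assumes "even CARD('l)" and "CARD('l) \<ge> 4" and "u > 0" and "\<tau> > 0"
    and "H\<^sub>I = H_int u" and "H\<^sub>h = H_hop \<tau>" and "Hp = H_pink \<tau>" and "Hg = H_gold \<tau>"
    and "H = H\<^sub>I + Hp + Hg"
  shows "\<exists>W_PLAQ \<ge> 0.
    W_PLAQ \<le> W_SO2 H\<^sub>I H\<^sub>h + 3/24 * opnorm (comm (comm Hp Hg) Hg) \<and>
    (\<forall>t \<ge> 0.
      opnorm (mexp ((\<i> * complex_of_real t) *\<^sub>C H)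
        - mexp ((\<i> * complex_of_real (t/2)) *\<^sub>C H\<^sub>I)
          ** mexp ((\<i> * complex_of_real (t/2)) *\<^sub>C Hp)
          ** mexp ((\<i> * complex_of_real t) *\<^sub>C Hg)
          ** mexp ((\<i> * complex_of_real (t/2)) *\<^sub>C Hp)
          ** mexp ((\<i> * complex_of_real (t/2)) *\<^sub>C H\<^sub>I))
      \<le> W_PLAQ * t ^ 3)"
proof (intro exI conjI allI impI)
  \<comment> \<open>The witness is the upper bound itself.\<close>
  let ?W = "W_SO2 H\<^sub>I H\<^sub>h + 3/24 * opnorm (comm (comm Hp Hg) Hg)"
  show "0 \<le> ?W"
    unfolding W_SO2_def by (intro add_nonneg_nonneg mult_nonneg_nonneg opnorm_nonneg) auto
  show "?W \<le> ?W" ..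
  fix t :: real
  assume "0 \<le> t"
  let ?e = "\<lambda>s M. mexp ((\<i> * complex_of_real s) *\<^sub>C M)"
  have herm: "dagger H\<^sub>I = H\<^sub>I" "dagger H\<^sub>h = H\<^sub>h" "dagger Hp = Hp" "dagger Hg = Hg"
    using assms
    by (simp_all add: dagger_H_int H_hop_def H_pink_def H_gold_def dagger_hopping_on)
  have hop: "H\<^sub>h = Hp + Hg"
    using assms H_hop_eq_pink_gold by blast
  have H: "H = H\<^sub>I + H\<^sub>h"
    using assms(9) hop by (simp add: add.assoc)
  let ?S = "?e (t/2) H\<^sub>I ** ?e t H\<^sub>h ** ?e (t/2) H\<^sub>I"
  let ?P = "?e (t/2) Hp ** ?e t Hg ** ?e (t/2) Hp"
  let ?Q = "?e (t/2) H\<^sub>I ** ?P ** ?e (t/2) H\<^sub>I"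
  have 1: "opnorm (?e t H - ?S) \<le> W_SO2 H\<^sub>I H\<^sub>h * t ^ 3"
    unfolding H W_SO2_def
    by (rule strang_splitting_error_hermitian[OF herm(1,2) \<open>0 \<le> t\<close>])
  \<comment> \<open>The outer interaction exponentials are contractions, so replacing the hopping
    evolution inside the product costs no more than replacing it alone.\<close>
  have "opnorm (?S - ?Q) \<le> opnorm (?e t H\<^sub>h - ?P)"
  proof -
    have "?S - ?Q = ?e (t/2) H\<^sub>I ** (?e t H\<^sub>h - ?P) ** ?e (t/2) H\<^sub>I"
      by (simp add: matrix_mult_diff_left matrix_mult_diff_right)
    then show ?thesis
      using opnorm_mult_contractions_le[OF opnorm_mexp_hermitian_le_1 opnorm_mexp_hermitian_le_1]
        herm by metis
  qed
  also have "\<dots> \<le> (1/12 * opnorm (comm (comm Hp Hg) Hg) + 1/24 * opnorm (comm (comm Hp Hg) Hp)) * t ^ 3"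
    unfolding hop by (rule strang_splitting_error_hermitian[OF herm(3,4) \<open>0 \<le> t\<close>])
  also have "\<dots> \<le> 3/24 * opnorm (comm (comm Hp Hg) Hg) * t ^ 3"
    using opnorm_comm_pink_le_gold[OF assms(1), of \<tau>] assms(7,8) \<open>0 \<le> t\<close>
    by (intro mult_right_mono) auto
  finally have 2: "opnorm (?S - ?Q) \<le> 3/24 * opnorm (comm (comm Hp Hg) Hg) * t ^ 3" .
  have "opnorm (?e t H - ?Q) \<le> ?W * t ^ 3"
    unfolding distrib_right by (rule order_trans[OF opnorm_diff_triangle add_mono[OF 1 2]])
  then show "opnorm (?e t H - ?e (t/2) H\<^sub>I ** ?e (t/2) Hp ** ?e t Hg ** ?e (t/2) Hp ** ?e (t/2) H\<^sub>I)
    \<le> ?W * t ^ 3"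
    by (simp only: matrix_mul_assoc)
qed

end
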